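(* Let $0\le a<b$ and let $f:[a,b]\to\mathbb{R}$ be a convex function on $[a,b]$. Then for any $x\in[a,b]$ and $\alpha\ge1$, the following inequality holds: $$\frac{\Gamma(\alpha)}{b-a}(b-x)^{1-\alpha}J_a^{\alpha}f(b)-J_a^{\alpha-1}\big(P_2(x,b)f(b)\big)-f(x)$$ $$\le\frac{1}{\alpha(\alpha+1)}\left[\alpha\frac{(b-x)^2}{b-a}f_-'(b)-\left((b-a)^{\alpha}(b-x)^{1-\alpha}+\alpha\frac{(b-x)^2}{b-a}-(\alpha+1)(b-x)\right)f_+'(a)\right],$$ where $$P_2(x,t)=\begin{cases}\dfrac{t-a}{b-a}(b-x)^{1-\alpha}\,\Gamma(\alpha), & a\le t<x,\\[2mm] \dfrac{t-b}{b-a}(b-x)^{1-\alpha}\,\Gamma(\alpha), & x\le t\le b.\end{cases}$$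
   Context: $f_-'(b)$ and $f_+'(a)$ are the left derivative of $f$ at $b$ and the right derivative of $f$ at $a$. For $\beta\ge 0$ and $a\ge0$ the Riemann-Liouville fractional integral is $J_a^{\beta}g(y)=\frac{1}{\Gamma(\beta)}\int_a^y (y-t)^{\beta-1}g(t)\,dt$ if $\beta>0$, and $J_a^0g(y)=g(y)$. The notation $J_a^{\beta}(P_2(x,b)g(b))$ means $J_a^\beta$ applied to the function $t\mapsto P_2(x,t)g(t)$ and evaluated at $b$ (with $x$ fixed): for $\beta>0$ it equals $\frac{1}{\Gamma(\beta)}\int_a^b (b-t)^{\beta-1}P_2(x,t)g(t)\,dt$, and for $\beta=0$ it equals $P_2(x,b)g(b)$.
   Formalization: The case x = b with α > 1 is excluded, because there (b-x)^{1-α} is a negative power of zero and the inequality is undefined; for α = 1 all x in [a,b] are allowed, with (b-x)^0 = 1 at x = b. *)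

theory Defs
  imports "HOL-Analysis.Analysis"
begin

text \<open>The library has \<open>0 powr 0 = 0\<close>, whereas \<open>(b - x)\<close> to the power \<open>1 - \<alpha>\<close> must be \<open>1\<close>
  when \<open>\<alpha> = 1\<close> and \<open>x = b\<close>.\<close>

definition rpow :: "real \<Rightarrow> real \<Rightarrow> real" where
  "rpow x p = (if p = 0 then 1 else x powr p)"

text \<open>Riemann-Liouville fractional integral of order \<open>\<beta> \<ge> 0\<close> with base point \<open>a\<close>, for \<open>y \<ge> a\<close>.\<close>

definition rl_integral :: "real \<Rightarrow> real \<Rightarrow> (real \<Rightarrow> real) \<Rightarrow> real \<Rightarrow> real" where
  "rl_integral a \<beta> g y =
     (if \<beta> = 0 then g y
      else 1 / Gamma \<beta> * (LINT t:{a..y}|lborel. rpow (y - t) (\<beta> - 1) * g t))"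

text \<open>One-sided derivatives are extended reals: at an endpoint of its domain a convex function
  has one-sided derivatives only in this sense. The lemmas below show that the limits exist
  there, and that finite values are the usual one-sided derivatives.\<close>

definition left_deriv :: "(real \<Rightarrow> real) \<Rightarrow> real \<Rightarrow> ereal" where
  "left_deriv f c = Lim (at_left c) (\<lambda>t. ereal ((f t - f c) / (t - c)))"

definition right_deriv :: "(real \<Rightarrow> real) \<Rightarrow> real \<Rightarrow> ereal" where
  "right_deriv f c = Lim (at_right c) (\<lambda>t. ereal ((f t - f c) / (t - c)))"

definition P2 :: "real \<Rightarrow> real \<Rightarrow> real \<Rightarrow> real \<Rightarrow> real \<Rightarrow> real" where
  "P2 a b \<alpha> x t =
     (if t < x then (t - a) / (b - a) * rpow (b - x) (1 - \<alpha>) * Gamma \<alpha>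
      else (t - b) / (b - a) * rpow (b - x) (1 - \<alpha>) * Gamma \<alpha>)"

lemma left_deriv_eq:
  assumes "(f has_real_derivative D) (at_left c)"
  shows "left_deriv f c = ereal D"
  using assms unfolding left_deriv_def has_field_derivative_iff
  by (intro tendsto_Lim tendsto_ereal) simp_all

lemma right_deriv_eq:
  assumes "(f has_real_derivative D) (at_right c)"
  shows "right_deriv f c = ereal D"
  using assms unfolding right_deriv_def has_field_derivative_iff
  by (intro tendsto_Lim tendsto_ereal) simp_all

lemma convex_left_deriv_tendsto:
  assumes "a < b" and f: "convex_on {a..b} f"
  shows "((\<lambda>t. ereal ((f t - f b) / (t - b))) \<longlongrightarrow> left_deriv f b) (at_left b)"
proof -
  let ?q = "\<lambda>t. ereal ((f t - f b) / (t - b))"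
  have "?q u \<le> ?q v" if "u \<in> {a<..}" "v < b" "u \<le> v" for u v
    using convex_on_slope_le(2)[OF f, of u b v] that by (cases "u = v") auto
  then have "(?q \<longlongrightarrow> Sup (?q ` ({..<b} \<inter> {a<..}))) (at b within ({..<b} \<inter> {a<..}))"
    by (intro Lim_left_bound[where K = \<infinity>]) auto
  moreover have "at b within ({..<b} \<inter> {a<..}) = at_left b"
    using \<open>a < b\<close> by (intro at_within_nhd[of _ "{a<..}"]) auto
  ultimately show ?thesis
    unfolding left_deriv_def using tendsto_Lim[of "at_left b" ?q] by auto
qed

lemma convex_right_deriv_tendsto:
  assumes "a < b" and f: "convex_on {a..b} f"
  shows "((\<lambda>t. ereal ((f t - f a) / (t - a))) \<longlongrightarrow> right_deriv f a) (at_right a)"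
proof -
  let ?q = "\<lambda>t. ereal ((f t - f a) / (t - a))"
  have "?q u \<le> ?q v" if "v \<in> {..<b}" "a < u" "u \<le> v" for u v
  proof (cases "u = v")
    case False
    then have "(f a - f u) / (a - u) \<le> (f a - f v) / (a - v)"
      using convex_on_slope_le(1)[OF f, of a v u] that by auto
    moreover have "(f a - f w) / (a - w) = (f w - f a) / (w - a)" for w
      by (metis minus_diff_eq minus_divide_divide)
    ultimately show ?thesis by simp
  qed simp
  then have "(?q \<longlongrightarrow> Inf (?q ` ({a<..} \<inter> {..<b}))) (at a within ({a<..} \<inter> {..<b}))"
    by (intro Lim_right_bound[where K = "-\<infinity>"]) auto
  moreover have "at a within ({a<..} \<inter> {..<b}) = at_right a"
    using \<open>a < b\<close> by (intro at_within_nhd[of _ "{..<b}"]) auto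
  ultimately show ?thesis
    unfolding right_deriv_def using tendsto_Lim[of "at_right a" ?q] by auto
qed

end

theory Submission
  imports Defs
begin

text \<open>
  Put \<open>K = (b - x) powr (1 - \<alpha>) / (b - a)\<close>. Since \<open>\<Gamma>(\<alpha>) = (\<alpha> - 1) \<Gamma>(\<alpha> - 1)\<close>, all Gamma factors cancel when the
  fractional integrals are written out, and splitting the integrals at \<open>x\<close> turns the left-hand side
  into \<open>K (B + A)\<close>, where
    \<open>B = \<integral> w'(t) f(t) dt - w(x) f(x)\<close> over \<open>[a, x]\<close> with \<open>w(t) = (b - t) powr (\<alpha> - 1) * (t - a)\<close>, and
    \<open>A = \<alpha> \<integral> (b - t) powr (\<alpha> - 1) * f(t) dt - (b - x) powr \<alpha> * f(x)\<close> over \<open>[x, b]\<close>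
  (lemma \<open>montgomery_split\<close>). Formally, integration by parts gives \<open>B = - \<integral> w f'\<close> and
  \<open>A = \<integral> (b - t) powr \<alpha> * f'(t) dt\<close>, and the theorem follows from \<open>f' \<ge> f'\<^sub>+(a)\<close> on the first interval and
  \<open>f' \<le> f'\<^sub>-(b)\<close> on the second.

  The proof below does not differentiate \<open>f\<close>. It compares \<open>f\<close> with lines whose slopes are the two
  endpoint derivatives. On \<open>[x, b]\<close> the weight is nonnegative, so integrating
  \<open>f(t) \<le> f(x) + f'\<^sub>-(b) (t - x)\<close> is enough (\<open>upper_part_le\<close>). On \<open>[a, x]\<close> the weight \<open>w'\<close> is
  nonnegative up to some \<open>m\<close> and nonpositive after it. The line through the point
  \<open>(m, f(m))\<close> with slope \<open>f'\<^sub>+(a)\<close> lies above \<open>f\<close> before \<open>m\<close> and below \<open>f\<close> after \<open>m\<close>, so the product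
  of \<open>w'\<close> with the line dominates the product of \<open>w'\<close> with \<open>f\<close> everywhere
  (\<open>integral_weight_deriv_mult_le\<close>, \<open>lower_part_le\<close>).

  A convex function may jump up at an endpoint, which makes the derivative there infinite. Then the
  right-hand side is \<open>\<infinity>\<close> unless the coefficient of that derivative is zero. The coefficients are
  positive multiples of the integrals of the weights \<open>(b - t) powr \<alpha>\<close> and \<open>w\<close>, so a zero coefficient means
  \<open>x = b\<close> or \<open>x = a\<close>, and then the corresponding part \<open>A\<close> or \<open>B\<close> vanishes.
\<close>

section \<open>Powers with \<open>rpow\<close>\<close>

lemma rpow_nonneg: "0 \<le> s \<Longrightarrow> 0 \<le> rpow s p"
  by (simp add: rpow_def)

lemma rpow_pos: "0 < s \<Longrightarrow> 0 < rpow s p"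
  by (simp add: rpow_def)

lemma rpow_add_1:
  assumes "0 < s \<or> 0 \<le> s \<and> 0 \<le> p"
  shows "rpow s (p + 1) = s * rpow s p"
proof (cases "s = 0")
  case False
  with assms have "0 < s" by auto
  then have "s powr (p + 1) = s * s powr p" by (simp add: powr_add)
  with False assms show ?thesis by (cases "p + 1 = 0") (auto simp: rpow_def)
qed (use assms in \<open>auto simp: rpow_def\<close>)

lemma rpow_inverse:
  assumes "0 < s \<or> p = 0"
  shows "rpow s (- p) * rpow s p = 1"
  using assms by (auto simp: rpow_def powr_minus)

lemma continuous_on_rpow_diff:
  fixes b :: real
  assumes "v \<le> b" and "0 \<le> p \<or> v < b"
  shows "continuous_on {u..v} (\<lambda>t. rpow (b - t) p)"
proof (cases "p = 0")
  case False
  then have "continuous_on {u..v} (\<lambda>t. (b - t) powr p)"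
    using assms by (intro continuous_on_powr' continuous_intros) auto
  then show ?thesis using False by (simp add: rpow_def)
qed (simp add: rpow_def)

lemma has_field_derivative_rpow_diff:
  fixes b :: real
  assumes "t < b"
  shows "((\<lambda>t. rpow (b - t) p) has_field_derivative - p * rpow (b - t) (p - 1)) (at t)"
proof (cases "p = 0")
  case False
  have "((\<lambda>t. (b - t) powr p) has_field_derivative - p * (b - t) powr (p - 1)) (at t)"
    using assms by (auto intro!: derivative_eq_intros)
  moreover have "rpow (b - t) (p - 1) = (b - t) powr (p - 1)"
    using assms by (simp add: rpow_def)
  ultimately show ?thesis using False by (simp add: rpow_def)
qed (simp add: rpow_def)

section \<open>Convex functions on a compact interval\<close>

text \<open>The larger endpoint value bounds \<open>f\<close> from above; reflecting in the midpoint \<open>c\<close> turns this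
  into a lower bound, because \<open>2 f(c) \<le> f(t) + f(a + b - t)\<close>.\<close>

lemma convex_on_Icc_bounded:
  fixes f :: "real \<Rightarrow> real"
  assumes f: "convex_on {a..b} f"
  shows "\<exists>M. \<forall>t\<in>{a..b}. \<bar>f t\<bar> \<le> M"
proof -
  define U where "U = max (f a) (f b)"
  define c where "c = (a + b) / 2"
  have up: "f t \<le> U" if "t \<in> {a..b}" for t
    using convex_on_le_max[OF f that] by (simp add: U_def)
  have low: "2 * f c - U \<le> f t" if t: "t \<in> {a..b}" for t
  proof -
    have s: "a + b - t \<in> {a..b}" using t by auto
    have "f ((1 - 1/2) *\<^sub>R t + (1/2) *\<^sub>R (a + b - t)) \<le> (1 - 1/2) * f t + 1/2 * f (a + b - t)"
      by (rule convex_onD[OF f]) (use t s in auto)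
    moreover have "(1 - 1/2) *\<^sub>R t + (1/2) *\<^sub>R (a + b - t) = c"
      by (simp add: c_def field_simps)
    ultimately show ?thesis using up[OF s] by auto
  qed
  have "\<forall>t\<in>{a..b}. \<bar>f t\<bar> \<le> \<bar>U\<bar> + \<bar>2 * f c - U\<bar>"
  proof
    fix t assume "t \<in> {a..b}"
    from up[OF this] low[OF this] show "\<bar>f t\<bar> \<le> \<bar>U\<bar> + \<bar>2 * f c - U\<bar>" by linarith
  qed
  then show ?thesis ..
qed

text \<open>A convex function may jump at the endpoints, so measurability comes from continuity in the
  open interval and the two endpoints are adjoined by hand.\<close>

lemma convex_on_Icc_borel_measurable:
  fixes f :: "real \<Rightarrow> real"
  assumes f: "convex_on {a..b} f"
  shows "(\<lambda>t. indicator {a..b} t * f t) \<in> borel_measurable borel"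
proof -
  have "convex_on {a<..<b} f"
    by (rule convex_on_subset[OF f]) auto
  then have "continuous_on {a<..<b} f"
    by (intro convex_on_continuous) auto
  then have "(\<lambda>t. indicator {a<..<b} t *\<^sub>R f t) \<in> borel_measurable borel"
    by (intro borel_measurable_continuous_on_indicator) auto
  then have "(\<lambda>t. if t = a \<and> a \<le> b then f a else if t = b \<and> a \<le> b then f b
      else indicator {a<..<b} t *\<^sub>R f t) \<in> borel_measurable borel"
    by measurable
  also have "(\<lambda>t. if t = a \<and> a \<le> b then f a else if t = b \<and> a \<le> b then f b
      else indicator {a<..<b} t *\<^sub>R f t) = (\<lambda>t. indicator {a..b} t * f t)"
    by (auto simp: fun_eq_iff indicator_def)
  finally show ?thesis .
qed

text \<open>Boundedness and measurability of \<open>f\<close> reduce the existence of the integral of a weight times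
  \<open>f\<close> to that of the weight alone.\<close>

lemma set_integrable_mult_convex:
  fixes f g :: "real \<Rightarrow> real"
  assumes f: "convex_on {a..b} f" and g: "set_integrable lborel {u..v} g"
    and sub: "{u..v} \<subseteq> {a..b}"
  shows "set_integrable lborel {u..v} (\<lambda>t. g t * f t)"
proof -
  obtain M where M: "\<forall>t\<in>{a..b}. \<bar>f t\<bar> \<le> M"
    using convex_on_Icc_bounded[OF f] by blast
  have eq: "indicator {u..v} t *\<^sub>R (g t * f t) =
      (indicator {u..v} t *\<^sub>R g t) * (indicator {a..b} t * f t)" for t
    using sub by (auto simp: indicator_def)
  show ?thesis
    unfolding set_integrable_def
  proof (rule Bochner_Integration.integrable_bound)
    show "integrable lborel (\<lambda>t. M * (indicator {u..v} t *\<^sub>R g t))"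
      using g unfolding set_integrable_def by (rule integrable_mult_right)
    have "(\<lambda>t. indicator {u..v} t *\<^sub>R g t) \<in> borel_measurable lborel"
      using g unfolding set_integrable_def by (rule borel_measurable_integrable)
    then have "(\<lambda>t. indicator {u..v} t *\<^sub>R g t) \<in> borel_measurable borel"
      by simp
    from borel_measurable_times[OF this convex_on_Icc_borel_measurable[OF f]]
    show "(\<lambda>t. indicator {u..v} t *\<^sub>R (g t * f t)) \<in> borel_measurable lborel"
      by (simp only: eq measurable_lborel2)
    have "\<bar>g t\<bar> * \<bar>f t\<bar> \<le> \<bar>M\<bar> * \<bar>g t\<bar>" if "t \<in> {u..v}" for t
    proof -
      have "\<bar>f t\<bar> \<le> \<bar>M\<bar>" using M sub that by (meson abs_ge_self order_trans subsetD)
      then show ?thesis using mult_right_mono[of "\<bar>f t\<bar>" "\<bar>M\<bar>" "\<bar>g t\<bar>"] by (simp add: mult.commute)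
    qed
    then show "AE t in lborel. norm (indicator {u..v} t *\<^sub>R (g t * f t))
        \<le> norm (M * (indicator {u..v} t *\<^sub>R g t))"
      by (intro AE_I2) (auto simp: indicator_def abs_mult)
  qed
qed

text \<open>Slopes of chords ending at \<open>b\<close> increase to the left derivative. In particular that derivative
  is never \<open>-\<infinity>\<close>, and symmetrically the right derivative at \<open>a\<close> is never \<open>\<infinity>\<close>.\<close>

lemma slope_le_left_deriv:
  assumes "a \<le> u" "u < b" and f: "convex_on {a..b} f"
  shows "ereal ((f b - f u) / (b - u)) \<le> left_deriv f b"
proof (rule tendsto_lowerbound)
  show "((\<lambda>t. ereal ((f t - f b) / (t - b))) \<longlongrightarrow> left_deriv f b) (at_left b)"
    using assms by (intro convex_left_deriv_tendsto[of a b f]) auto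
  show "\<forall>\<^sub>F t in at_left b. ereal ((f b - f u) / (b - u)) \<le> ereal ((f t - f b) / (t - b))"
    unfolding eventually_at_left_field
  proof (intro exI[of _ u] conjI allI impI)
    fix t assume "u < t" "t < b"
    then show "ereal ((f b - f u) / (b - u)) \<le> ereal ((f t - f b) / (t - b))"
      using convex_on_slope_le(2)[OF f, of u b t] assms minus_divide_divide[of "f u - f b" "u - b"]
      by simp
  qed (use assms in auto)
qed simp

lemma right_deriv_le_slope:
  assumes "a < u" "u \<le> b" and f: "convex_on {a..b} f"
  shows "right_deriv f a \<le> ereal ((f u - f a) / (u - a))"
proof (rule tendsto_upperbound)
  show "((\<lambda>t. ereal ((f t - f a) / (t - a))) \<longlongrightarrow> right_deriv f a) (at_right a)"
    using assms by (intro convex_right_deriv_tendsto[of a b f]) auto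
  show "\<forall>\<^sub>F t in at_right a. ereal ((f t - f a) / (t - a)) \<le> ereal ((f u - f a) / (u - a))"
    unfolding eventually_at_right_field
  proof (intro exI[of _ u] conjI allI impI)
    fix t assume "a < t" "t < u"
    then show "ereal ((f t - f a) / (t - a)) \<le> ereal ((f u - f a) / (u - a))"
      using convex_on_slope_le(1)[OF f, of a u t] assms minus_divide_divide[of "f t - f a" "t - a"]
        minus_divide_divide[of "f u - f a" "u - a"]
      by simp
  qed (use assms in auto)
qed simp

text \<open>For a finite endpoint derivative, these two lemmas replace the bounds \<open>f' \<le> f'\<^sub>-(b)\<close> and
  \<open>f' \<ge> f'\<^sub>+(a)\<close> by their integrated forms.\<close>

lemma convex_le_left_deriv_line:
  assumes f: "convex_on {a..b} f" and p: "left_deriv f b = ereal p"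
    and "a \<le> s" "s \<le> t" "t \<le> b"
  shows "f t \<le> f s + p * (t - s)"
proof (cases "s = t")
  case False
  with assms have st: "s < t" by simp
  have "(f t - f s) / (t - s) \<le> (f b - f s) / (b - s)"
  proof (cases "t = b")
    case False
    then show ?thesis
      using convex_on_slope_le(1)[OF f, of s b t] assms st
        minus_divide_divide[of "f t - f s" "t - s"] minus_divide_divide[of "f b - f s" "b - s"]
      by simp
  qed simp
  also have "\<dots> \<le> p"
    using slope_le_left_deriv[OF _ _ f, of s] assms st by simp
  finally show ?thesis using st by (simp add: field_simps)
qed simp

lemma convex_ge_right_deriv_line:
  assumes f: "convex_on {a..b} f" and r: "right_deriv f a = ereal r"
    and "a \<le> s" "s \<le> t" "t \<le> b"
  shows "f s + r * (t - s) \<le> f t"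
proof (cases "s = t")
  case False
  with assms have st: "s < t" by simp
  have "r \<le> (f t - f a) / (t - a)"
    using right_deriv_le_slope[OF _ _ f, of t] assms st by simp
  also have "\<dots> \<le> (f t - f s) / (t - s)"
  proof (cases "s = a")
    case False
    then show ?thesis
      using convex_on_slope_le(2)[OF f, of a t s] assms st
        minus_divide_divide[of "f t - f s" "t - s"] minus_divide_divide[of "f t - f a" "t - a"]
      by simp
  qed simp
  finally show ?thesis using st by (simp add: field_simps)
qed simp

section \<open>The two weights of the Montgomery identity\<close>

definition lower_weight :: "real \<Rightarrow> real \<Rightarrow> real \<Rightarrow> real \<Rightarrow> real" where
  "lower_weight a b \<alpha> t = rpow (b - t) (\<alpha> - 1) * (t - a)"

definition lower_weight_deriv :: "real \<Rightarrow> real \<Rightarrow> real \<Rightarrow> real \<Rightarrow> real" where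
  "lower_weight_deriv a b \<alpha> t =
     rpow (b - t) (\<alpha> - 1) - (\<alpha> - 1) * (rpow (b - t) (\<alpha> - 2) * (t - a))"

text \<open>The integral of \<open>lower_weight\<close> over \<open>[a, x]\<close> in closed form; multiplied by
  \<open>\<alpha> (\<alpha> + 1) K\<close> it is the coefficient of the right derivative in the theorem.\<close>

definition lower_weight_integral :: "real \<Rightarrow> real \<Rightarrow> real \<Rightarrow> real \<Rightarrow> real" where
  "lower_weight_integral a b \<alpha> x =
     (rpow (b - a) (\<alpha> + 1) - (\<alpha> + 1) * (b - a) * rpow (b - x) \<alpha> + \<alpha> * rpow (b - x) (\<alpha> + 1))
     / (\<alpha> * (\<alpha> + 1))"

lemma lower_weight_has_derivative:
  assumes "t < b"
  shows "(lower_weight a b \<alpha> has_field_derivative lower_weight_deriv a b \<alpha> t) (at t)"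
  unfolding lower_weight_def[abs_def] lower_weight_deriv_def
  using assms
  by (auto intro!: derivative_eq_intros has_field_derivative_rpow_diff simp: algebra_simps)

lemma lower_weight_integral_has_derivative:
  assumes "t < b" "0 < \<alpha>"
  shows "(lower_weight_integral a b \<alpha> has_field_derivative lower_weight a b \<alpha> t) (at t)"
proof -
  have pw: "rpow (b - t) \<alpha> = (b - t) * rpow (b - t) (\<alpha> - 1)"
    using rpow_add_1[of "b - t" "\<alpha> - 1"] assms by simp
  note d = has_field_derivative_rpow_diff[OF assms(1)]
  have "(lower_weight_integral a b \<alpha> has_field_derivative
     (0 - (\<alpha> + 1) * (b - a) * (- \<alpha> * rpow (b - t) (\<alpha> - 1))
       + \<alpha> * (- (\<alpha> + 1) * rpow (b - t) (\<alpha> + 1 - 1))) / (\<alpha> * (\<alpha> + 1))) (at t)"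
    unfolding lower_weight_integral_def[abs_def]
    by (intro DERIV_cdivide DERIV_add DERIV_diff DERIV_const DERIV_cmult d)
  moreover have "0 - (\<alpha> + 1) * (b - a) * (- \<alpha> * rpow (b - t) (\<alpha> - 1))
       + \<alpha> * (- (\<alpha> + 1) * rpow (b - t) (\<alpha> + 1 - 1))
     = \<alpha> * (\<alpha> + 1) * lower_weight a b \<alpha> t"
    by (simp add: pw lower_weight_def algebra_simps)
  moreover have "\<alpha> * (\<alpha> + 1) \<noteq> 0" using assms by simp
  ultimately show ?thesis by simp
qed

lemma continuous_on_lower_weight:
  assumes "1 \<le> \<alpha>" "x \<le> b"
  shows "continuous_on {a..x} (lower_weight a b \<alpha>)"
  unfolding lower_weight_def[abs_def] using assms
  by (intro continuous_intros continuous_on_rpow_diff) auto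

lemma continuous_on_lower_weight_integral:
  assumes "1 \<le> \<alpha>" "x \<le> b"
  shows "continuous_on {a..x} (lower_weight_integral a b \<alpha>)"
  unfolding lower_weight_integral_def[abs_def] using assms
  by (intro continuous_intros continuous_on_rpow_diff) auto

lemma continuous_on_lower_weight_deriv:
  assumes "1 \<le> \<alpha>" "x \<le> b" "x = b \<longrightarrow> \<alpha> = 1"
  shows "continuous_on {a..x} (lower_weight_deriv a b \<alpha>)"
proof (cases "\<alpha> = 1")
  case True
  then show ?thesis by (simp add: lower_weight_deriv_def[abs_def] rpow_def)
next
  case False
  with assms show ?thesis
    unfolding lower_weight_deriv_def[abs_def]
    by (intro continuous_intros continuous_on_rpow_diff) auto
qed

lemma lower_weight_integral_at_left:
  assumes "a < b" "0 < \<alpha>"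
  shows "lower_weight_integral a b \<alpha> a = 0"
proof -
  have "rpow (b - a) (\<alpha> + 1) = (b - a) * rpow (b - a) \<alpha>"
    using rpow_add_1[of "b - a" \<alpha>] assms by simp
  then have "rpow (b - a) (\<alpha> + 1) - (\<alpha> + 1) * (b - a) * rpow (b - a) \<alpha>
      + \<alpha> * rpow (b - a) (\<alpha> + 1) = 0"
    by (simp only:) (simp add: algebra_simps)
  then show ?thesis by (simp add: lower_weight_integral_def)
qed

lemma lower_weight_has_integral:
  assumes "a < b" "1 \<le> \<alpha>" "a \<le> x" "x \<le> b"
  shows "(lower_weight a b \<alpha> has_integral lower_weight_integral a b \<alpha> x) {a..x}"
proof -
  have "(lower_weight a b \<alpha> has_integral
      lower_weight_integral a b \<alpha> x - lower_weight_integral a b \<alpha> a) {a..x}"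
    using assms continuous_on_lower_weight_integral[of \<alpha> x b a]
    by (intro fundamental_theorem_of_calculus_interior)
      (auto intro!: lower_weight_integral_has_derivative
        simp flip: has_real_derivative_iff_has_vector_derivative)
  then show ?thesis using assms by (simp add: lower_weight_integral_at_left)
qed

lemma lower_weight_integral_pos:
  assumes "a < x" "x \<le> b" "1 \<le> \<alpha>"
  shows "0 < lower_weight_integral a b \<alpha> x"
proof -
  have "lower_weight_integral a b \<alpha> a < lower_weight_integral a b \<alpha> x"
  proof (rule DERIV_pos_imp_increasing_open[OF assms(1)])
    fix t assume t: "a < t" "t < x"
    then have "0 < lower_weight a b \<alpha> t"
      using assms by (simp add: lower_weight_def rpow_pos)
    then show "\<exists>y. (lower_weight_integral a b \<alpha> has_field_derivative y) (at t) \<and> 0 < y"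
      using lower_weight_integral_has_derivative[of t b \<alpha> a] t assms by auto
  qed (use assms continuous_on_lower_weight_integral in auto)
  then show ?thesis using lower_weight_integral_at_left[of a b \<alpha>] assms by simp
qed

text \<open>The linear factor shows that the only sign change is from positive to negative, at
  \<open>a + (b - a) / \<alpha>\<close>.\<close>

lemma lower_weight_deriv_factor:
  assumes "t < b"
  shows "lower_weight_deriv a b \<alpha> t = rpow (b - t) (\<alpha> - 2) * ((b - a) - \<alpha> * (t - a))"
proof -
  have "\<alpha> - 2 + 1 = \<alpha> - 1" by simp
  then show ?thesis
    using rpow_add_1[of "b - t" "\<alpha> - 2"] assms
    by (simp add: lower_weight_deriv_def) (simp add: algebra_simps)
qed

text \<open>The antiderivative comes from integrating by parts: the weight is the derivative of
  \<open>- (b - t) powr \<alpha>\<close>, and the slope \<open>p\<close> is then multiplied by the integral of \<open>(b - t) powr \<alpha>\<close>.\<close>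

lemma upper_weight_first_moment:
  assumes "1 \<le> \<alpha>" "x \<le> b"
  shows "((\<lambda>t. \<alpha> * rpow (b - t) (\<alpha> - 1) * (c + p * (t - x))) has_integral
     (rpow (b - x) \<alpha> * c + p * (rpow (b - x) (\<alpha> + 1) / (\<alpha> + 1)))) {x..b}"
proof -
  let ?F = "\<lambda>t. - (rpow (b - t) \<alpha> * (c + p * (t - x))) - p * (rpow (b - t) (\<alpha> + 1) / (\<alpha> + 1))"
  have "((\<lambda>t. \<alpha> * rpow (b - t) (\<alpha> - 1) * (c + p * (t - x))) has_integral ?F b - ?F x) {x..b}"
  proof (rule fundamental_theorem_of_calculus_interior)
    show "continuous_on {x..b} ?F"
      using assms by (intro continuous_intros continuous_on_rpow_diff) auto
    fix t assume "t \<in> {x<..<b}"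
    then have d: "((\<lambda>t. rpow (b - t) q) has_field_derivative - q * rpow (b - t) (q - 1)) (at t)" for q
      by (intro has_field_derivative_rpow_diff) auto
    have "((\<lambda>t. c + p * (t - x)) has_field_derivative p) (at t)"
      by (auto intro!: derivative_eq_intros)
    from DERIV_diff[OF DERIV_minus[OF DERIV_mult[OF d[of \<alpha>] this]]
        DERIV_cmult[OF DERIV_cdivide[OF d[of "\<alpha> + 1"], of "\<alpha> + 1"], of p]]
    have "(?F has_field_derivative
        - (- \<alpha> * rpow (b - t) (\<alpha> - 1) * (c + p * (t - x)) + p * rpow (b - t) \<alpha>)
        - p * (- (\<alpha> + 1) * rpow (b - t) (\<alpha> + 1 - 1) / (\<alpha> + 1))) (at t)" .
    moreover have "- (\<alpha> + 1) * X / (\<alpha> + 1) = - X" for X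
      using assms by (simp add: divide_eq_eq algebra_simps)
    ultimately show "(?F has_vector_derivative \<alpha> * rpow (b - t) (\<alpha> - 1) * (c + p * (t - x))) (at t)"
      unfolding has_real_derivative_iff_has_vector_derivative[symmetric]
      by (simp only:) simp
  qed (use assms in auto)
  moreover have "rpow (b - b) \<alpha> = 0" "rpow (b - b) (\<alpha> + 1) = 0"
    using assms by (simp_all add: rpow_def)
  ultimately show ?thesis by (simp add: algebra_simps)
qed

section \<open>Bounds for finite one-sided derivatives\<close>

lemma upper_part_le:
  assumes I: "((\<lambda>t. rpow (b - t) (\<alpha> - 1) * f t) has_integral I) {x..b}"
    and "1 \<le> \<alpha>" "x \<le> b"
    and line: "\<And>t. t \<in> {x..b} \<Longrightarrow> f t \<le> f x + p * (t - x)"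
  shows "\<alpha> * I - rpow (b - x) \<alpha> * f x \<le> rpow (b - x) (\<alpha> + 1) / (\<alpha> + 1) * p"
proof -
  have "((\<lambda>t. \<alpha> * (rpow (b - t) (\<alpha> - 1) * f t)) has_integral \<alpha> * I) {x..b}"
    using has_integral_mult_right[OF I] .
  moreover have "\<alpha> * (rpow (b - t) (\<alpha> - 1) * f t)
      \<le> \<alpha> * rpow (b - t) (\<alpha> - 1) * (f x + p * (t - x))" if "t \<in> {x..b}" for t
    using mult_left_mono[OF line[OF that], of "\<alpha> * rpow (b - t) (\<alpha> - 1)"] that assms
    by (simp add: rpow_nonneg mult.assoc)
  ultimately have "\<alpha> * I \<le> rpow (b - x) \<alpha> * f x + p * (rpow (b - x) (\<alpha> + 1) / (\<alpha> + 1))"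
    by (rule has_integral_le[OF _ upper_weight_first_moment[OF assms(2,3)]])
  then show ?thesis by (simp add: mult.commute)
qed

text \<open>This is \<open>\<integral> w' f - w(x) f(x) \<le> - r \<integral> w\<close>, which for smooth \<open>f\<close> with \<open>f' \<ge> r\<close> is integration by
  parts. Without derivatives of \<open>f\<close> the sign change of \<open>v = w'\<close> at \<open>m\<close> is what is needed: the line
  of slope \<open>r\<close> through \<open>(m, f(m))\<close> crosses the graph of \<open>f\<close> from above to below exactly where \<open>v\<close> passes
  from nonnegative to nonpositive, so \<open>v f\<close> is at most \<open>v\<close> times the line. The integral of the latter
  is explicit, and \<open>f(m) + r (x - m) \<le> f(x)\<close> finishes.\<close>

lemma integral_weight_deriv_mult_le:
  fixes f v w :: "real \<Rightarrow> real"
  assumes I: "((\<lambda>t. v t * f t) has_integral I) {a..x}" and W: "(w has_integral W) {a..x}"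
    and ax: "a \<le> x" and w: "continuous_on {a..x} w" "w a = 0" "0 \<le> w x"
    and v: "\<And>t. t \<in> {a<..<x} \<Longrightarrow> (w has_field_derivative v t) (at t)"
    and m: "m \<in> {a..x}"
    and pos: "\<And>t. t \<in> {a..x} \<Longrightarrow> t < m \<Longrightarrow> 0 \<le> v t"
    and neg: "\<And>t. t \<in> {a..x} \<Longrightarrow> m < t \<Longrightarrow> v t \<le> 0"
    and line: "\<And>s t. a \<le> s \<Longrightarrow> s \<le> t \<Longrightarrow> t \<le> x \<Longrightarrow> f s + r * (t - s) \<le> f t"
  shows "I - w x * f x \<le> - (W * r)"
proof -
  \<comment> \<open>The integrand is the derivative of \<open>w\<close> times the line.\<close>
  have "((\<lambda>t. v t * (f m + r * (t - m)) + r * w t) has_integral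
      w x * (f m + r * (x - m)) - w a * (f m + r * (a - m))) {a..x}"
  proof (rule fundamental_theorem_of_calculus_interior[OF ax])
    show "continuous_on {a..x} (\<lambda>t. w t * (f m + r * (t - m)))"
      by (intro continuous_intros w)
    show "((\<lambda>t. w t * (f m + r * (t - m))) has_vector_derivative
        v t * (f m + r * (t - m)) + r * w t) (at t)" if "t \<in> {a<..<x}" for t
      unfolding has_real_derivative_iff_has_vector_derivative[symmetric]
      by (auto intro!: derivative_eq_intros v that)
  qed
  from has_integral_diff[OF this has_integral_mult_right[OF W, of r]]
  have lin: "((\<lambda>t. v t * (f m + r * (t - m))) has_integral
      w x * (f m + r * (x - m)) - r * W) {a..x}"
    using w by simp
  have "v t * f t \<le> v t * (f m + r * (t - m))" if t: "t \<in> {a..x}" for t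
  proof (cases t m rule: linorder_cases)
    case less
    then show ?thesis
      using line[of t m] pos[OF t less] t m by (intro mult_left_mono) (auto simp: algebra_simps)
  next
    case greater
    then show ?thesis
      using line[of m t] neg[OF t greater] t m by (intro mult_left_mono_neg) auto
  qed simp
  from has_integral_le[OF I lin this] have "I \<le> w x * (f m + r * (x - m)) - r * W" by simp
  also have "\<dots> \<le> w x * f x - r * W"
    using line[of m x] m w by (intro diff_right_mono mult_left_mono) auto
  finally show ?thesis by (simp add: mult.commute)
qed

lemma lower_part_le:
  assumes I: "((\<lambda>t. lower_weight_deriv a b \<alpha> t * f t) has_integral I) {a..x}"
    and "a < b" "a \<le> x" "x \<le> b" "1 \<le> \<alpha>" "x = b \<longrightarrow> \<alpha> = 1"
    and line: "\<And>s t. a \<le> s \<Longrightarrow> s \<le> t \<Longrightarrow> t \<le> x \<Longrightarrow> f s + r * (t - s) \<le> f t"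
  shows "I - lower_weight a b \<alpha> x * f x \<le> - (lower_weight_integral a b \<alpha> x * r)"
proof (rule integral_weight_deriv_mult_le[OF I])
  define m where "m = min x (a + (b - a) / \<alpha>)"
  show "m \<in> {a..x}" using assms by (simp add: m_def)
  show "0 \<le> lower_weight_deriv a b \<alpha> t" if "t \<in> {a..x}" "t < m" for t
  proof -
    have "t < b" "\<alpha> * (t - a) \<le> b - a"
      using that assms by (auto simp: m_def field_simps)
    then show ?thesis
      by (simp add: lower_weight_deriv_factor rpow_nonneg)
  qed
  show "lower_weight_deriv a b \<alpha> t \<le> 0" if t: "t \<in> {a..x}" "m < t" for t
  proof -
    from t have "m < x" by auto
    then have *: "a + (b - a) / \<alpha> < t" using t by (auto simp: m_def min_def split: if_splits)
    \<comment> \<open>For \<open>x = b\<close> also \<open>\<alpha> = 1\<close>, so the sign change is at \<open>b\<close> and \<open>t\<close> cannot pass it.\<close>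
    have "t < b" using * t assms by (cases "x = b") auto
    moreover have "b - a \<le> \<alpha> * (t - a)" using * assms by (auto simp: field_simps)
    ultimately show ?thesis
      by (simp add: lower_weight_deriv_factor rpow_nonneg mult_nonneg_nonpos)
  qed
  show "0 \<le> lower_weight a b \<alpha> x"
    using assms by (simp add: lower_weight_def rpow_nonneg)
  show "lower_weight a b \<alpha> a = 0" by (simp add: lower_weight_def)
qed (use assms in \<open>auto intro!: lower_weight_has_integral continuous_on_lower_weight
      lower_weight_has_derivative\<close>)

section \<open>Splitting the left-hand side\<close>

lemma set_lborel_has_integral:
  fixes g :: "real \<Rightarrow> real"
  assumes "set_integrable lborel S g"
  shows "(g has_integral (LINT t:S|lborel. g t)) S"
  using set_borel_integral_eq_integral[OF assms] by (simp add: has_integral_integral)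

lemma rl_integral_split:
  fixes f :: "real \<Rightarrow> real"
  assumes f: "convex_on {a..b} f" and "a \<le> x" "x \<le> b" "1 \<le> \<alpha>"
    and I: "((\<lambda>t. rpow (b - t) (\<alpha> - 1) * f t) has_integral I) {a..x}"
    and J: "((\<lambda>t. rpow (b - t) (\<alpha> - 1) * f t) has_integral J) {x..b}"
  shows "Gamma \<alpha> * rl_integral a \<alpha> f b = I + J"
proof -
  have "set_integrable lborel {a..b} (\<lambda>t. rpow (b - t) (\<alpha> - 1) * f t)"
    using assms by (intro set_integrable_mult_convex[OF f] borel_integrable_atLeastAtMost'
        continuous_on_rpow_diff) auto
  from has_integral_unique[OF set_lborel_has_integral[OF this] has_integral_combine[OF _ _ I J]]
  have "(LINT t:{a..b}|lborel. rpow (b - t) (\<alpha> - 1) * f t) = I + J"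
    using assms(2,3) .
  moreover have "Gamma \<alpha> > 0" "\<alpha> \<noteq> 0" using assms(4) by (auto intro: Gamma_real_pos)
  ultimately show ?thesis by (simp add: rl_integral_def)
qed

text \<open>To the right of \<open>x\<close> the factor \<open>t - b\<close> of the kernel absorbs the singularity of
  \<open>(b - t) powr (\<alpha> - 2)\<close>, so the integral exists there although \<open>\<alpha> - 2\<close> may be negative; to the left,
  \<open>b - t\<close> is at least \<open>b - x > 0\<close>. The point \<open>t = x\<close>, where the kernel jumps, does not influence the
  integral.\<close>

lemma rl_integral_P2:
  fixes f :: "real \<Rightarrow> real"
  assumes f: "convex_on {a..b} f" and "a < b" "a \<le> x" "x \<le> b" "1 < \<alpha>" "x < b"
    and I: "((\<lambda>t. rpow (b - t) (\<alpha> - 2) * (t - a) * f t) has_integral I) {a..x}"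
    and J: "((\<lambda>t. rpow (b - t) (\<alpha> - 1) * f t) has_integral J) {x..b}"
  shows "rl_integral a (\<alpha> - 1) (\<lambda>t. P2 a b \<alpha> x t * f t) b
       = (\<alpha> - 1) * (rpow (b - x) (1 - \<alpha>) / (b - a)) * (I - J)"
proof -
  define C where "C = rpow (b - x) (1 - \<alpha>) / (b - a) * Gamma \<alpha>"
  let ?\<phi> = "\<lambda>t. rpow (b - t) (\<alpha> - 1 - 1) * (P2 a b \<alpha> x t * f t)"
  have low: "?\<phi> t = C * (rpow (b - t) (\<alpha> - 2) * (t - a) * f t)" if "t \<in> {a..<x}" for t
    using that by (simp add: P2_def C_def)
  have upp: "?\<phi> t = - C * (rpow (b - t) (\<alpha> - 1) * f t)" if "t \<in> {x..b}" for t
  proof (cases "t = b")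
    case True
    then show ?thesis using assms by (simp add: P2_def rpow_def)
  next
    case False
    then have "rpow (b - t) (\<alpha> - 1) = (b - t) * rpow (b - t) (\<alpha> - 2)"
      using rpow_add_1[of "b - t" "\<alpha> - 2"] that by (simp add: algebra_simps)
    moreover have "P2 a b \<alpha> x t = - C * (b - t)"
      using that assms by (simp add: P2_def C_def field_simps)
    ultimately show ?thesis by simp
  qed
  have "set_integrable lborel {a..<x} (\<lambda>t. C * (rpow (b - t) (\<alpha> - 2) * (t - a) * f t))"
  proof (rule set_integrable_subset)
    show "set_integrable lborel {a..x} (\<lambda>t. C * (rpow (b - t) (\<alpha> - 2) * (t - a) * f t))"
      using assms by (intro set_integrable_mult_right set_integrable_mult_convex[OF f]
          borel_integrable_atLeastAtMost' continuous_intros continuous_on_rpow_diff) auto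
  qed auto
  then have "set_integrable lborel {a..<x} ?\<phi>"
    by (rule set_integrable_cong[OF refl refl, THEN iffD2, rotated]) (rule low)
  moreover have "set_integrable lborel {x..b} (\<lambda>t. - C * (rpow (b - t) (\<alpha> - 1) * f t))"
    using assms by (intro set_integrable_mult_right set_integrable_mult_convex[OF f]
        borel_integrable_atLeastAtMost' continuous_on_rpow_diff) auto
  then have "set_integrable lborel {x..b} ?\<phi>"
    by (rule set_integrable_cong[OF refl refl, THEN iffD2, rotated]) (rule upp)
  ultimately have "set_integrable lborel ({a..<x} \<union> {x..b}) ?\<phi>"
    by (intro set_integrable_Un) auto
  moreover have "{a..<x} \<union> {x..b} = {a..b}" using assms by auto
  ultimately have int: "set_integrable lborel {a..b} ?\<phi>" by simp
  have "(?\<phi> has_integral C * I) {a..x}"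
    by (rule has_integral_spike_finite[OF _ _ has_integral_mult_right[OF I, of C], of "{x}"])
      (rule finite.intros, rule finite.intros, rule low, force)
  moreover have "(?\<phi> has_integral - C * J) {x..b}"
    by (rule has_integral_eq[OF upp[symmetric] has_integral_mult_right[OF J, of "- C"]])
  ultimately have "(?\<phi> has_integral C * I + - C * J) {a..b}"
    using assms by (intro has_integral_combine[of a x b]) auto
  from has_integral_unique[OF set_lborel_has_integral[OF int] this]
  have "(LINT t:{a..b}|lborel. ?\<phi> t) = C * (I - J)" by (simp add: algebra_simps)
  moreover have "Gamma \<alpha> = (\<alpha> - 1) * Gamma (\<alpha> - 1)"
    using Gamma_plus1[of "\<alpha> - 1"] assms nonpos_Ints_nonpos[of "\<alpha> - 1"] by force
  moreover have "Gamma (\<alpha> - 1) \<noteq> 0" using Gamma_real_pos[of "\<alpha> - 1"] assms by linarith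
  ultimately show ?thesis
    using assms by (simp add: rl_integral_def C_def)
qed

text \<open>The term \<open>f(x)\<close> is distributed over the two parts by \<open>K (w(x) + (b - x) powr \<alpha>) = 1\<close>. In each part it
  is the boundary term that integration by parts would produce.\<close>

lemma montgomery_split:
  fixes f :: "real \<Rightarrow> real"
  assumes f: "convex_on {a..b} f" and ab: "a < b" and x: "x \<in> {a..b}"
    and al: "1 \<le> \<alpha>" and xb: "x = b \<longrightarrow> \<alpha> = 1"
  obtains I J where
    "((\<lambda>t. lower_weight_deriv a b \<alpha> t * f t) has_integral I) {a..x}"
    "((\<lambda>t. rpow (b - t) (\<alpha> - 1) * f t) has_integral J) {x..b}"
    "Gamma \<alpha> / (b - a) * rpow (b - x) (1 - \<alpha>) * rl_integral a \<alpha> f b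
       - rl_integral a (\<alpha> - 1) (\<lambda>t. P2 a b \<alpha> x t * f t) b - f x
     = rpow (b - x) (1 - \<alpha>) / (b - a) *
        ((I - lower_weight a b \<alpha> x * f x) + (\<alpha> * J - rpow (b - x) \<alpha> * f x))"
proof -
  define K where "K = rpow (b - x) (1 - \<alpha>) / (b - a)"
  have Kone: "K * (lower_weight a b \<alpha> x + rpow (b - x) \<alpha>) = 1"
  proof -
    have "rpow (b - x) (- (\<alpha> - 1)) * rpow (b - x) (\<alpha> - 1) = 1"
      by (rule rpow_inverse) (use x xb in auto)
    then have "rpow (b - x) (1 - \<alpha>) * rpow (b - x) (\<alpha> - 1) = 1" by simp
    moreover have "rpow (b - x) \<alpha> = (b - x) * rpow (b - x) (\<alpha> - 1)"
      using rpow_add_1[of "b - x" "\<alpha> - 1"] x al by simp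
    then have "lower_weight a b \<alpha> x + rpow (b - x) \<alpha> = rpow (b - x) (\<alpha> - 1) * (b - a)"
      by (simp add: lower_weight_def algebra_simps)
    ultimately show ?thesis using ab by (simp add: K_def)
  qed
  have ex: "\<exists>I. ((\<lambda>t. g t * f t) has_integral I) {u..v}"
    if "continuous_on {u..v} g" "{u..v} \<subseteq> {a..b}" for g u v
    using set_lborel_has_integral set_integrable_mult_convex[OF f
        borel_integrable_atLeastAtMost'[OF that(1)] that(2)] by blast
  obtain I0 where I0: "((\<lambda>t. rpow (b - t) (\<alpha> - 1) * f t) has_integral I0) {a..x}"
    using ex[of a x "\<lambda>t. rpow (b - t) (\<alpha> - 1)"] x al continuous_on_rpow_diff[of x b "\<alpha> - 1" a]
    by auto
  obtain J where J: "((\<lambda>t. rpow (b - t) (\<alpha> - 1) * f t) has_integral J) {x..b}"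
    using ex[of x b "\<lambda>t. rpow (b - t) (\<alpha> - 1)"] x al continuous_on_rpow_diff[of b b "\<alpha> - 1" x]
    by auto
  have RL: "Gamma \<alpha> * rl_integral a \<alpha> f b = I0 + J"
    by (rule rl_integral_split[OF f _ _ _ I0 J]) (use x al in auto)
  have "\<exists>I1. ((\<lambda>t. lower_weight_deriv a b \<alpha> t * f t) has_integral I0 - (\<alpha> - 1) * I1) {a..x}
      \<and> rl_integral a (\<alpha> - 1) (\<lambda>t. P2 a b \<alpha> x t * f t) b = (\<alpha> - 1) * K * (I1 - J)"
  proof (cases "\<alpha> = 1")
    case True
    \<comment> \<open>The operator of order \<open>0\<close> evaluates at \<open>b\<close>, where the kernel vanishes.\<close>
    then show ?thesis
      using I0 x by (auto simp: lower_weight_deriv_def rl_integral_def P2_def rpow_def)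
  next
    case False
    with al xb x have al1: "1 < \<alpha>" and xb': "x < b" by auto
    have "continuous_on {a..x} (\<lambda>t. rpow (b - t) (\<alpha> - 2) * (t - a))"
      using xb' by (intro continuous_intros continuous_on_rpow_diff) auto
    then obtain I1 where
      I1: "((\<lambda>t. rpow (b - t) (\<alpha> - 2) * (t - a) * f t) has_integral I1) {a..x}"
      using ex[of a x] x by force
    have "((\<lambda>t. lower_weight_deriv a b \<alpha> t * f t) has_integral I0 - (\<alpha> - 1) * I1) {a..x}"
      using has_integral_diff[OF I0 has_integral_mult_right[OF I1, of "\<alpha> - 1"]]
      by (simp add: lower_weight_deriv_def algebra_simps)
    moreover have "rl_integral a (\<alpha> - 1) (\<lambda>t. P2 a b \<alpha> x t * f t) b = (\<alpha> - 1) * K * (I1 - J)"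
      unfolding K_def by (rule rl_integral_P2[OF f ab _ _ al1 xb' I1 J]) (use x in auto)
    ultimately show ?thesis by blast
  qed
  then obtain I1 where
    I1: "((\<lambda>t. lower_weight_deriv a b \<alpha> t * f t) has_integral I0 - (\<alpha> - 1) * I1) {a..x}"
    and P: "rl_integral a (\<alpha> - 1) (\<lambda>t. P2 a b \<alpha> x t * f t) b = (\<alpha> - 1) * K * (I1 - J)"
    by blast
  have "Gamma \<alpha> / (b - a) * rpow (b - x) (1 - \<alpha>) * rl_integral a \<alpha> f b = K * (I0 + J)"
    unfolding RL[symmetric] by (simp add: K_def)
  moreover have "f x = K * (lower_weight a b \<alpha> x + rpow (b - x) \<alpha>) * f x"
    using Kone by simp
  ultimately have "Gamma \<alpha> / (b - a) * rpow (b - x) (1 - \<alpha>) * rl_integral a \<alpha> f b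
       - rl_integral a (\<alpha> - 1) (\<lambda>t. P2 a b \<alpha> x t * f t) b - f x
     = K * ((I0 - (\<alpha> - 1) * I1 - lower_weight a b \<alpha> x * f x)
        + (\<alpha> * J - rpow (b - x) \<alpha> * f x))"
    using P by (simp add: algebra_simps)
  then show ?thesis using that[OF I1 J] by (simp add: K_def)
qed

section \<open>Infinite one-sided derivatives\<close>

text \<open>An inequality that is known for finite derivatives extends to infinite ones, provided it holds
  in the degenerate case of a zero coefficient, since \<open>0 * \<infinity> = 0\<close> in \<^typ>\<open>ereal\<close>.\<close>

lemma ereal_le_mult:
  fixes L :: ereal
  assumes "0 \<le> c" "L \<noteq> - \<infinity>" "c = 0 \<Longrightarrow> A \<le> 0" "\<And>l. L = ereal l \<Longrightarrow> A \<le> c * l"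
  shows "ereal A \<le> ereal c * L"
proof (cases L)
  case PInf
  then show ?thesis using assms by (cases "c = 0") auto
qed (use assms in auto)

lemma ereal_le_uminus_mult:
  fixes R :: ereal
  assumes "0 \<le> c" "R \<noteq> \<infinity>" "c = 0 \<Longrightarrow> A \<le> 0" "\<And>r. R = ereal r \<Longrightarrow> A \<le> - (c * r)"
  shows "ereal A \<le> - (ereal c * R)"
  using ereal_le_mult[of c "- R" A] assms by (cases R) auto

text \<open>\<open>S * L\<close> is never \<open>-\<infinity>\<close> and \<open>W * R\<close> is never \<open>\<infinity>\<close>, so the difference is well defined and the common
  factor can be moved across it.\<close>

lemma ereal_weighted_diff_scale:
  fixes L R :: ereal
  assumes "0 < n" "0 < K" "0 \<le> S" "0 \<le> W" "L \<noteq> - \<infinity>" "R \<noteq> \<infinity>"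
  shows "ereal (1 / n) * (ereal (n * (K * S)) * L - ereal (n * (K * W)) * R)
       = ereal K * (ereal S * L - ereal W * R)"
proof (cases L; cases R)
  fix l r assume "L = ereal l" "R = ereal r"
  then show ?thesis using assms by (simp add: field_simps)
qed (use assms in \<open>cases "S = 0"; cases "W = 0"; simp\<close>)+

section \<open>The inequality\<close>

theorem theorem2:
  fixes f :: "real \<Rightarrow> real" and a b x \<alpha> :: real
  assumes "0 \<le> a" and "a < b"
    and "convex_on {a..b} f"
    and "x \<in> {a..b}" and "1 \<le> \<alpha>"
    and "x = b \<longrightarrow> \<alpha> = 1"
  shows "ereal (Gamma \<alpha> / (b - a) * rpow (b - x) (1 - \<alpha>) * rl_integral a \<alpha> f b
            - rl_integral a (\<alpha> - 1) (\<lambda>t. P2 a b \<alpha> x t * f t) b - f x)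
         \<le> ereal (1 / (\<alpha> * (\<alpha> + 1))) *
            (ereal (\<alpha> * ((b - x)\<^sup>2 / (b - a))) * left_deriv f b
             - ereal (rpow (b - a) \<alpha> * rpow (b - x) (1 - \<alpha>)
                      + \<alpha> * ((b - x)\<^sup>2 / (b - a)) - (\<alpha> + 1) * (b - x)) * right_deriv f a)"
proof -
  note f = assms(3)
  define K where "K = rpow (b - x) (1 - \<alpha>) / (b - a)"
  define S where "S = rpow (b - x) (\<alpha> + 1) / (\<alpha> + 1)"
  define W where "W = lower_weight_integral a b \<alpha> x"
  have x: "a \<le> x" "x \<le> b" and al: "0 < \<alpha>" "0 < \<alpha> * (\<alpha> + 1)" using assms by auto
  obtain I J where I: "((\<lambda>t. lower_weight_deriv a b \<alpha> t * f t) has_integral I) {a..x}"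
    and J: "((\<lambda>t. rpow (b - t) (\<alpha> - 1) * f t) has_integral J) {x..b}"
    and split: "Gamma \<alpha> / (b - a) * rpow (b - x) (1 - \<alpha>) * rl_integral a \<alpha> f b
       - rl_integral a (\<alpha> - 1) (\<lambda>t. P2 a b \<alpha> x t * f t) b - f x
     = K * ((I - lower_weight a b \<alpha> x * f x) + (\<alpha> * J - rpow (b - x) \<alpha> * f x))"
    unfolding K_def by (rule montgomery_split[OF f assms(2,4,5,6)])
  define B where "B = I - lower_weight a b \<alpha> x * f x"
  define A where "A = \<alpha> * J - rpow (b - x) \<alpha> * f x"
  have K: "0 < K" using assms rpow_pos[of "b - x" "1 - \<alpha>"]
    by (cases "x = b") (auto simp: K_def rpow_def)
  have S: "0 \<le> S" using x al by (simp add: S_def rpow_nonneg)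
  have W: "0 \<le> W"
    using lower_weight_integral_pos[of a x b \<alpha>] lower_weight_integral_at_left[of a b \<alpha>] x assms
    by (cases "x = a") (auto simp: W_def)
  have L: "left_deriv f b \<noteq> - \<infinity>"
    using slope_le_left_deriv[OF _ assms(2) f] by auto
  have R: "right_deriv f a \<noteq> \<infinity>"
    using right_deriv_le_slope[OF assms(2) _ f] by auto

  have A: "ereal A \<le> ereal S * left_deriv f b"
  proof (rule ereal_le_mult)
    show "A \<le> 0" if "S = 0"
    proof -
      have "x = b" using that x al rpow_pos[of "b - x" "\<alpha> + 1"] by (cases "x = b") (auto simp: S_def)
      with J have "J = 0" by (metis has_integral_refl(2) has_integral_unique atLeastAtMost_singleton)
      with \<open>x = b\<close> al show ?thesis by (simp add: A_def rpow_def)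
    qed
    show "A \<le> S * p" if "left_deriv f b = ereal p" for p
      unfolding A_def S_def
      using convex_le_left_deriv_line[OF f that, of x] x assms
      by (intro upper_part_le[OF J]) auto
  qed (rule S L)+
  have B: "ereal B \<le> - (ereal W * right_deriv f a)"
  proof (rule ereal_le_uminus_mult)
    show "B \<le> 0" if "W = 0"
    proof -
      have "x = a" using that lower_weight_integral_pos[of a x b \<alpha>] x assms
        by (cases "x = a") (auto simp: W_def)
      with I have "I = 0" by (metis has_integral_refl(2) has_integral_unique atLeastAtMost_singleton)
      with \<open>x = a\<close> show ?thesis by (simp add: B_def lower_weight_def)
    qed
    show "B \<le> - (W * r)" if "right_deriv f a = ereal r" for r
      unfolding B_def W_def
      using convex_ge_right_deriv_line[OF f that] x assms
      by (intro lower_part_le[OF I]) auto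
  qed (rule W R)+

  \<comment> \<open>Both coefficients of the theorem are the weight integrals multiplied by \<open>K\<close>.\<close>
  have inv: "rpow (b - x) (1 - \<alpha>) * rpow (b - x) (\<alpha> - 1) = 1"
    using rpow_inverse[of "b - x" "\<alpha> - 1"] x assms by auto
  have pw: "rpow (b - x) \<alpha> = (b - x) * rpow (b - x) (\<alpha> - 1)"
    "rpow (b - x) (\<alpha> + 1) = (b - x)\<^sup>2 * rpow (b - x) (\<alpha> - 1)"
    "rpow (b - a) (\<alpha> + 1) = (b - a) * rpow (b - a) \<alpha>"
    using rpow_add_1[of "b - x" "\<alpha> - 1"] rpow_add_1[of "b - x" \<alpha>] rpow_add_1[of "b - a" \<alpha>] x assms
    by (simp_all add: power2_eq_square)
  have invq: "rpow (b - x) (1 - \<alpha>) * (q * rpow (b - x) (\<alpha> - 1)) = q" for q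
    using inv by (simp add: mult.left_commute)
  have "(\<alpha> + 1) * (K * S) = (b - x)\<^sup>2 / (b - a)"
    using al by (simp add: K_def S_def pw invq)
  then have cS: "\<alpha> * ((b - x)\<^sup>2 / (b - a)) = \<alpha> * (\<alpha> + 1) * (K * S)"
    by (simp only: mult.assoc)
  have "\<alpha> * (\<alpha> + 1) * (K * W) = rpow (b - x) (1 - \<alpha>) * ((b - a) * rpow (b - a) \<alpha>
      - (\<alpha> + 1) * (b - a) * ((b - x) * rpow (b - x) (\<alpha> - 1))
      + \<alpha> * ((b - x)\<^sup>2 * rpow (b - x) (\<alpha> - 1))) / (b - a)"
    using al by (simp add: K_def W_def lower_weight_integral_def pw)
  also have "\<dots> = (rpow (b - x) (1 - \<alpha>) * ((b - a) * rpow (b - a) \<alpha>)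
      - (\<alpha> + 1) * (b - a) * (rpow (b - x) (1 - \<alpha>) * ((b - x) * rpow (b - x) (\<alpha> - 1)))
      + \<alpha> * (rpow (b - x) (1 - \<alpha>) * ((b - x)\<^sup>2 * rpow (b - x) (\<alpha> - 1)))) / (b - a)"
    by (simp add: algebra_simps)
  also have "\<dots> = rpow (b - a) \<alpha> * rpow (b - x) (1 - \<alpha>)
      + \<alpha> * ((b - x)\<^sup>2 / (b - a)) - (\<alpha> + 1) * (b - x)"
    unfolding invq using assms(2) by (simp add: field_simps)
  finally have cW: "rpow (b - a) \<alpha> * rpow (b - x) (1 - \<alpha>)
      + \<alpha> * ((b - x)\<^sup>2 / (b - a)) - (\<alpha> + 1) * (b - x) = \<alpha> * (\<alpha> + 1) * (K * W)" ..

  have "ereal (A + B) \<le> ereal S * left_deriv f b - ereal W * right_deriv f a"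
    using add_mono[OF A B] by (simp add: minus_ereal_def)
  then have "ereal K * ereal (A + B) \<le> ereal K * (ereal S * left_deriv f b - ereal W * right_deriv f a)"
    using K by (intro ereal_mult_left_mono) auto
  also have "\<dots> = ereal (1 / (\<alpha> * (\<alpha> + 1))) * (ereal (\<alpha> * (\<alpha> + 1) * (K * S)) * left_deriv f b
      - ereal (\<alpha> * (\<alpha> + 1) * (K * W)) * right_deriv f a)"
    using al K S W L R by (intro ereal_weighted_diff_scale[symmetric]) auto
  finally show ?thesis
    unfolding split cW A_def B_def unfolding cS by (simp add: add.commute)
qed

end
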